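(* Let $q \in \mathbb{N}$ be a prime power, let $n,d \in \mathbb{N}$ with $2 \le d \le n$, and let $G = \overline{\mathcal{G}_{q,n,d}}$ be the complement of the generalized-Hamming graph. Then: (1) $G$ is edge-transitive if and only if either ($q=2$, $d=n-1$ and $n$ is even), or $d = n$. (2) $G$ is distance-transitive if and only if one of the following two conditions holds: (a) $q=2$, $d=n-1$ and $n$ is even; (b) $d = n$ and either $q=2$ or $n=2$.
   Context: For a prime power $q$ and $n,d\in\mathbb{N}$ with $2\le d\le n$, the generalized-Hamming graph $\mathcal{G}_{q,n,d}$ is the simple undirected graph with vertex set $\mathbb{F}_q^n$ in which two distinct vertices are adjacent if and only if their Hamming distance is less than $d$. Thus in the complement $\overline{\mathcal{G}_{q,n,d}}$ two vertices are adjacent if and only if their Hamming distance is at least $d$. A graph $G$ is edge-transitive if for every pair of edges $\{u_1,v_1\},\{u_2,v_2\}$ there is an automorphism of $G$ mapping the set $\{u_1,v_1\}$ to the set $\{u_2,v_2\}$. A graph $G$ is distance-transitive if for all vertices $u_1,u_2,v_1,v_2$ with $d_G(v_1,v_2)=d_G(u_1,u_2)$ (where $d_G$ is the graph distance) there is an automorphism of $G$ mapping $v_1$ to $u_1$ and $v_2$ to $u_2$. Vertices in different connected components are at distance $\infty$. *)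

theory Defs
  imports
    "HOL-Analysis.Finite_Cartesian_Product"
    "HOL-Number_Theory.Prime_Powers"
    "HOL-Library.Extended_Nat"
begin

text \<open>A simple undirected graph is a vertex set together with a set of two-element
  subsets of it.\<close>

type_synonym 'a ugraph = "'a set \<times> 'a set set"

abbreviation verts :: "'a ugraph \<Rightarrow> 'a set" where
  "verts G \<equiv> fst G"

abbreviation edges :: "'a ugraph \<Rightarrow> 'a set set" where
  "edges G \<equiv> snd G"

definition graph_complement :: "'a ugraph \<Rightarrow> 'a ugraph" where
  "graph_complement G =
     (verts G, {{u, v} | u v. u \<in> verts G \<and> v \<in> verts G \<and> u \<noteq> v \<and> {u, v} \<notin> edges G})"

definition automorphism :: "'a ugraph \<Rightarrow> ('a \<Rightarrow> 'a) \<Rightarrow> bool" where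
  "automorphism G f \<longleftrightarrow> bij_betw f (verts G) (verts G) \<and>
     (\<forall>u \<in> verts G. \<forall>v \<in> verts G. {f u, f v} \<in> edges G \<longleftrightarrow> {u, v} \<in> edges G)"

definition walk :: "'a ugraph \<Rightarrow> 'a list \<Rightarrow> bool" where
  "walk G p \<longleftrightarrow> p \<noteq> [] \<and> set p \<subseteq> verts G \<and>
     (\<forall>i. Suc i < length p \<longrightarrow> {p ! i, p ! Suc i} \<in> edges G)"

text \<open>The infimum of the empty set in \<^typ>\<open>enat\<close> is \<open>\<infinity>\<close>, which is thus the distance between
  vertices in different connected components.\<close>

definition graph_dist :: "'a ugraph \<Rightarrow> 'a \<Rightarrow> 'a \<Rightarrow> enat" where
  "graph_dist G u v =
     (INF p \<in> {p. walk G p \<and> hd p = u \<and> last p = v}. enat (length p - 1))"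

definition edge_transitive :: "'a ugraph \<Rightarrow> bool" where
  "edge_transitive G \<longleftrightarrow>
     (\<forall>e1 \<in> edges G. \<forall>e2 \<in> edges G. \<exists>f. automorphism G f \<and> f ` e1 = e2)"

definition distance_transitive :: "'a ugraph \<Rightarrow> bool" where
  "distance_transitive G \<longleftrightarrow>
     (\<forall>u1 \<in> verts G. \<forall>u2 \<in> verts G. \<forall>v1 \<in> verts G. \<forall>v2 \<in> verts G.
        graph_dist G v1 v2 = graph_dist G u1 u2 \<longrightarrow>
        (\<exists>f. automorphism G f \<and> f v1 = u1 \<and> f v2 = u2))"

definition hamming_dist :: "'a ^ 'n \<Rightarrow> 'a ^ 'n \<Rightarrow> nat" where
  "hamming_dist x y = card {i. x $ i \<noteq> y $ i}"

text \<open>The parameters \<open>q\<close> and \<open>n\<close> are carried by the type: \<open>q\<close> is the cardinality of the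
  finite field \<open>'f\<close>, and \<open>n\<close> that of the index type \<open>'n\<close>.\<close>

definition gen_hamming_graph :: "nat \<Rightarrow> ('f::{field,finite} ^ 'n::finite) ugraph" where
  "gen_hamming_graph d = (UNIV, {{x, y} | x y. x \<noteq> y \<and> hamming_dist x y < d})"

end

theory Submission
  imports Defs
begin

text \<open>Hamming isometries act transitively on the pairs at a given Hamming distance, so everything
  depends on which Hamming distances further automorphisms merge. The obstructions come from
  common neighbours: their number decreases weakly with the Hamming distance. For \<open>q \<ge> 3\<close> and
  \<open>d < n\<close> it drops strictly from distance \<open>d\<close> to \<open>d + 1\<close>, which separates two edges. For \<open>d < n\<close> it
  also drops from 2 to 3, so automorphisms preserve ``Hamming distance at most \<open>2 * k\<close>'' for every
  \<open>k\<close>. For \<open>q = 2\<close> this separates edges at distance \<open>d\<close> and \<open>n\<close> unless \<open>d = n - 1\<close> with \<open>n\<close> even, when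
  the graph is a folded cube, which has an extra automorphism. For \<open>d = n\<close>, if \<open>q \<ge> 3\<close> and \<open>n \<ge> 3\<close>,
  pairs at Hamming distance 1 and 2 have graph distance 2 but different numbers of common
  neighbours.\<close>

section \<open>Graph distance\<close>

text \<open>The infimum of a nonempty set in \<open>enat\<close> is attained, so a finite bound
  yields an actual walk; \<open>k\<close> edges correspond to \<open>Suc k\<close> listed
  vertices.\<close>

lemma graph_dist_le_iff:
  "graph_dist G u v \<le> enat k \<longleftrightarrow>
     (\<exists>p. walk G p \<and> hd p = u \<and> last p = v \<and> length p \<le> Suc k)"
proof
  assume le: "graph_dist G u v \<le> enat k"
  define A where "A = (\<lambda>p. enat (length p - 1)) ` {p. walk G p \<and> hd p = u \<and> last p = v}"
  have dist: "graph_dist G u v = Inf A"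
    by (simp add: graph_dist_def A_def)
  have "A \<noteq> {}"
    using le dist by (auto simp: Inf_enat_def)
  then have "Inf A \<in> A"
    unfolding Inf_enat_def by (auto intro: LeastI)
  then obtain p where "walk G p" "hd p = u" "last p = v" "Inf A = enat (length p - 1)"
    unfolding A_def by blast
  then show "\<exists>p. walk G p \<and> hd p = u \<and> last p = v \<and> length p \<le> Suc k"
    using le dist by (intro exI[of _ p]) auto
next
  assume "\<exists>p. walk G p \<and> hd p = u \<and> last p = v \<and> length p \<le> Suc k"
  then obtain p where p: "walk G p" "hd p = u" "last p = v" "length p \<le> Suc k"
    by blast
  have "graph_dist G u v \<le> enat (length p - 1)"
    unfolding graph_dist_def using p by (intro INF_lower) auto
  also have "\<dots> \<le> enat k"
    using p by simp
  finally show "graph_dist G u v \<le> enat k" .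
qed

lemma walk_singleton: "walk G [x] \<longleftrightarrow> x \<in> verts G"
  by (simp add: walk_def)

lemma walk_snoc:
  assumes "p \<noteq> []"
  shows "walk G (p @ [x]) \<longleftrightarrow> walk G p \<and> x \<in> verts G \<and> {last p, x} \<in> edges G"
proof -
  have "(\<forall>i. Suc i < length (p @ [x]) \<longrightarrow> {(p @ [x]) ! i, (p @ [x]) ! Suc i} \<in> edges G) \<longleftrightarrow>
        (\<forall>i. Suc i < length p \<longrightarrow> {p ! i, p ! Suc i} \<in> edges G) \<and> {last p, x} \<in> edges G"
    (is "?L \<longleftrightarrow> ?R")
  proof
    assume L: ?L
    have "{p ! i, p ! Suc i} \<in> edges G" if "Suc i < length p" for i
      using L[rule_format, of i] that by (simp add: nth_append)
    moreover have "{last p, x} \<in> edges G"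
      using L[rule_format, of "length p - 1"] assms by (simp add: nth_append last_conv_nth)
    ultimately show ?R by blast
  next
    assume R: ?R
    show ?L
    proof (intro allI impI)
      fix i
      assume "Suc i < length (p @ [x])"
      then consider "Suc i < length p" | "i = length p - 1" "Suc i = length p"
        by fastforce
      then show "{(p @ [x]) ! i, (p @ [x]) ! Suc i} \<in> edges G"
        using R assms by cases (simp_all add: nth_append last_conv_nth)
    qed
  qed
  then show ?thesis
    using assms by (auto simp: walk_def)
qed

lemma graph_dist_le_0_iff: "graph_dist G u v \<le> enat 0 \<longleftrightarrow> u = v \<and> u \<in> verts G"
proof
  assume "graph_dist G u v \<le> enat 0"
  then obtain p where p: "walk G p" "hd p = u" "last p = v" "length p \<le> Suc 0"
    unfolding graph_dist_le_iff by blast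
  then show "u = v \<and> u \<in> verts G"
    by (cases p) (auto simp: walk_def)
next
  assume "u = v \<and> u \<in> verts G"
  then show "graph_dist G u v \<le> enat 0"
    unfolding graph_dist_le_iff by (intro exI[of _ "[u]"]) (auto simp: walk_singleton)
qed

text \<open>Cutting off the last vertex of a walk turns the distance into a recursion on balls
  around \<open>u\<close>.\<close>

lemma graph_dist_le_Suc_iff:
  "graph_dist G u v \<le> enat (Suc k) \<longleftrightarrow>
     graph_dist G u v \<le> enat k \<or>
     (v \<in> verts G \<and> (\<exists>w. graph_dist G u w \<le> enat k \<and> {w, v} \<in> edges G))"
proof
  assume "graph_dist G u v \<le> enat (Suc k)"
  then obtain p where p: "walk G p" "hd p = u" "last p = v" "length p \<le> Suc (Suc k)"
    unfolding graph_dist_le_iff by blast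
  then obtain r where r: "p = r @ [v]"
    by (metis append_butlast_last_id walk_def)
  show "graph_dist G u v \<le> enat k \<or>
     (v \<in> verts G \<and> (\<exists>w. graph_dist G u w \<le> enat k \<and> {w, v} \<in> edges G))"
  proof (cases "r = []")
    case True
    then show ?thesis
      unfolding graph_dist_le_iff using p r by (intro disjI1 exI[of _ p]) simp
  next
    case False
    then have "walk G r" "v \<in> verts G" "{last r, v} \<in> edges G"
      using p r by (simp_all add: walk_snoc)
    moreover have "graph_dist G u (last r) \<le> enat k"
      unfolding graph_dist_le_iff using \<open>walk G r\<close> p r False by (intro exI[of _ r]) simp
    ultimately show ?thesis by blast
  qed
next
  assume "graph_dist G u v \<le> enat k \<or>
     (v \<in> verts G \<and> (\<exists>w. graph_dist G u w \<le> enat k \<and> {w, v} \<in> edges G))"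
  then show "graph_dist G u v \<le> enat (Suc k)"
  proof
    assume "graph_dist G u v \<le> enat k"
    then show ?thesis
      by (meson enat_ord_simps(1) le_SucI order_refl order_trans)
  next
    assume "v \<in> verts G \<and> (\<exists>w. graph_dist G u w \<le> enat k \<and> {w, v} \<in> edges G)"
    then obtain w p where v: "v \<in> verts G" "{w, v} \<in> edges G"
      and p: "walk G p" "hd p = u" "last p = w" "length p \<le> Suc k"
      unfolding graph_dist_le_iff by blast
    then have "p \<noteq> []"
      by (simp add: walk_def)
    then show ?thesis
      unfolding graph_dist_le_iff using v p
      by (intro exI[of _ "p @ [v]"]) (simp add: walk_snoc)
  qed
qed

lemma graph_dist_eqI:
  assumes "\<And>k. graph_dist G u v \<le> enat k \<longleftrightarrow> m \<le> k"
  shows "graph_dist G u v = enat m"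
proof (rule antisym)
  show "graph_dist G u v \<le> enat m"
    using assms by simp
  show "enat m \<le> graph_dist G u v"
    using assms by (cases "graph_dist G u v") (metis order_refl enat_ord_simps(1), simp)
qed

text \<open>Verifies a guessed closed form for the distance: the Lipschitz condition bounds the
  distance from below, the descent condition from above.\<close>

lemma graph_dist_eq_potential:
  fixes \<delta> :: "'a \<Rightarrow> nat"
  assumes verts: "verts G = UNIV"
    and zero: "\<And>x. \<delta> x = 0 \<longleftrightarrow> x = u"
    and lipschitz: "\<And>x y. {x, y} \<in> edges G \<Longrightarrow> \<delta> y \<le> Suc (\<delta> x)"
    and descent: "\<And>x. \<delta> x \<noteq> 0 \<Longrightarrow> \<exists>y. {y, x} \<in> edges G \<and> Suc (\<delta> y) = \<delta> x"
  shows "graph_dist G u v = enat (\<delta> v)"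
proof (rule graph_dist_eqI)
  show "graph_dist G u v \<le> enat k \<longleftrightarrow> \<delta> v \<le> k" for k
  proof (induction k arbitrary: v)
    case 0
    show ?case
      unfolding graph_dist_le_0_iff using verts zero by auto
  next
    case (Suc k)
    have "\<delta> v \<le> k \<or> (\<exists>w. \<delta> w \<le> k \<and> {w, v} \<in> edges G) \<longleftrightarrow> \<delta> v \<le> Suc k"
    proof
      assume "\<delta> v \<le> k \<or> (\<exists>w. \<delta> w \<le> k \<and> {w, v} \<in> edges G)"
      then show "\<delta> v \<le> Suc k"
        using lipschitz by fastforce
    next
      assume le: "\<delta> v \<le> Suc k"
      show "\<delta> v \<le> k \<or> (\<exists>w. \<delta> w \<le> k \<and> {w, v} \<in> edges G)"
      proof (cases "\<delta> v = 0")
        case False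
        then obtain y where "{y, v} \<in> edges G" "Suc (\<delta> y) = \<delta> v"
          using descent by blast
        then show ?thesis
          using le by (intro disjI2 exI[of _ y]) simp
      qed simp
    qed
    then show ?case
      unfolding graph_dist_le_Suc_iff Suc.IH using verts by simp
  qed
qed

lemma graph_dist_eq_0_iff:
  assumes "verts G = UNIV"
  shows "graph_dist G u v = 0 \<longleftrightarrow> u = v"
  using graph_dist_le_0_iff[of G u v] assms by (simp add: zero_enat_def[symmetric])

lemma graph_dist_le_1_iff:
  assumes "verts G = UNIV"
  shows "graph_dist G u v \<le> 1 \<longleftrightarrow> u = v \<or> {u, v} \<in> edges G"
  using graph_dist_le_Suc_iff[of G u v 0] assms
  by (auto simp: graph_dist_le_0_iff one_enat_def)

lemma enat_eq_1_iff: "x = 1 \<longleftrightarrow> x \<le> 1 \<and> x \<noteq> (0 :: enat)"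
  by (cases x) (auto simp: one_enat_def zero_enat_def)

lemma graph_dist_eq_1_iff:
  assumes "verts G = UNIV" and "{u} \<notin> edges G"
  shows "graph_dist G u v = 1 \<longleftrightarrow> {u, v} \<in> edges G"
  using assms by (auto simp: enat_eq_1_iff[of "graph_dist G u v"] graph_dist_eq_0_iff graph_dist_le_1_iff)

lemma graph_dist_eq_2I:
  assumes "verts G = UNIV" and "u \<noteq> v" and "{u, v} \<notin> edges G"
    and "{u, w} \<in> edges G" and "{w, v} \<in> edges G"
  shows "graph_dist G u v = enat 2"
proof -
  have "graph_dist G u v \<le> enat (Suc 1)"
    using assms graph_dist_le_1_iff[of G u w]
    by (subst graph_dist_le_Suc_iff) (auto simp: one_enat_def)
  moreover have "\<not> graph_dist G u v \<le> 1"
    using assms by (simp add: graph_dist_le_1_iff)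
  ultimately show ?thesis
    by (cases "graph_dist G u v") (auto simp: one_enat_def)
qed


section \<open>Hamming distance\<close>

lemma hamming_dist_commute: "hamming_dist x y = hamming_dist y x"
  unfolding hamming_dist_def by (rule arg_cong[where f = card]) auto

lemma hamming_dist_self [simp]: "hamming_dist x x = 0"
  by (simp add: hamming_dist_def)

lemma hamming_dist_eq_0_iff [simp]:
  fixes x y :: "'a ^ 'n::finite"
  shows "hamming_dist x y = 0 \<longleftrightarrow> x = y"
  by (auto simp: hamming_dist_def vec_eq_iff)

lemma hamming_dist_le_CARD:
  fixes x y :: "'a ^ 'n::finite"
  shows "hamming_dist x y \<le> CARD('n)"
  unfolding hamming_dist_def by (rule card_mono) auto

lemma hamming_dist_triangle:
  fixes x y z :: "'a ^ 'n::finite"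
  shows "hamming_dist x z \<le> hamming_dist x y + hamming_dist y z"
proof -
  have "hamming_dist x z \<le> card ({i. x $ i \<noteq> y $ i} \<union> {i. y $ i \<noteq> z $ i})"
    unfolding hamming_dist_def by (rule card_mono) auto
  also have "\<dots> \<le> hamming_dist x y + hamming_dist y z"
    unfolding hamming_dist_def by (rule card_Un_le)
  finally show ?thesis .
qed

section \<open>Changing a single coordinate\<close>

definition hamming_off :: "'n \<Rightarrow> 'a ^ 'n \<Rightarrow> 'a ^ 'n \<Rightarrow> nat" where
  "hamming_off i x y = card {j. j \<noteq> i \<and> x $ j \<noteq> y $ j}"

definition vupd :: "'a ^ 'n \<Rightarrow> 'n \<Rightarrow> 'a \<Rightarrow> 'a ^ 'n" where
  "vupd x i a = (\<chi> j. if j = i then a else x $ j)"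

lemma vupd_nth [simp]: "vupd x i a $ j = (if j = i then a else x $ j)"
  by (simp add: vupd_def)

lemma hamming_off_vupd [simp]:
  "hamming_off i (vupd x i a) y = hamming_off i x y"
  "hamming_off i x (vupd y i a) = hamming_off i x y"
  unfolding hamming_off_def by (auto intro!: arg_cong[where f = card])

lemma hamming_dist_split:
  fixes x y :: "'a ^ 'n::finite"
  shows "hamming_dist x y = of_bool (x $ i \<noteq> y $ i) + hamming_off i x y"
proof -
  have "{j. x $ j \<noteq> y $ j} =
      (if x $ i \<noteq> y $ i then insert i else id) {j. j \<noteq> i \<and> x $ j \<noteq> y $ j}"
    by auto
  then show ?thesis
    unfolding hamming_dist_def hamming_off_def by simp
qed

text \<open>Replacing the entries of \<open>x\<close> by those of \<open>y\<close> at
  \<open>a\<close> of the positions where they differ produces \<open>z\<close>.\<close>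

lemma hamming_dist_between:
  fixes x y :: "'a ^ 'n::finite"
  assumes "hamming_dist x y = a + b"
  shows "\<exists>z. hamming_dist x z = a \<and> hamming_dist z y = b"
proof -
  obtain T where T: "T \<subseteq> {i. x $ i \<noteq> y $ i}" "card T = a"
    using obtain_subset_with_card_n[of a "{i. x $ i \<noteq> y $ i}"] assms
    unfolding hamming_dist_def by (metis le_add1)
  define z where "z = (\<chi> i. if i \<in> T then y $ i else x $ i)"
  have "{i. x $ i \<noteq> z $ i} = T" and *: "{i. z $ i \<noteq> y $ i} = {i. x $ i \<noteq> y $ i} - T"
    using T(1) by (auto simp: z_def)
  moreover have "card ({i. x $ i \<noteq> y $ i} - T) = b"
    using T assms by (simp add: card_Diff_subset hamming_dist_def)
  ultimately show ?thesis
    using T(2) unfolding hamming_dist_def by (intro exI[of _ z]) simp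
qed

lemma ex_hamming_dist:
  fixes x :: "'a::zero_neq_one ^ 'n::finite"
  assumes "k \<le> CARD('n)"
  shows "\<exists>y. hamming_dist x y = k"
proof -
  have "x $ i \<noteq> (if x $ i = 0 then 1 else 0)" for i
    by simp
  then have "hamming_dist x (\<chi> i. if x $ i = 0 then 1 else 0) = k + (CARD('n) - k)"
    using assms by (simp add: hamming_dist_def)
  from hamming_dist_between[OF this] show ?thesis
    by blast
qed

text \<open>The isometry permutes the coordinates so that the positions where the two pairs differ
  match, and acts on each coordinate by an affine map.\<close>

lemma ex_hamming_isometry:
  fixes u1 u2 v1 v2 :: "'a::field ^ 'n::finite"
  assumes "hamming_dist v1 v2 = hamming_dist u1 u2"
  shows "\<exists>f. (\<forall>x y. hamming_dist (f x) (f y) = hamming_dist x y) \<and> f v1 = u1 \<and> f v2 = u2"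
proof -
  define A where "A = {i. u1 $ i \<noteq> u2 $ i}"
  define B where "B = {i. v1 $ i \<noteq> v2 $ i}"
  have card: "card A = card B"
    using assms by (simp add: hamming_dist_def A_def B_def)
  then obtain g where g: "bij_betw g A B"
    using finite_same_card_bij[of A B] by auto
  have "card (- A) = card (- B)"
    using card by (simp add: Compl_eq_Diff_UNIV card_Diff_subset)
  then obtain h where h: "bij_betw h (- A) (- B)"
    using finite_same_card_bij[of "- A" "- B"] by auto
  define \<sigma> where "\<sigma> i = (if i \<in> A then g i else h i)" for i
  have "bij_betw \<sigma> (A \<union> - A) (B \<union> - B)"
    unfolding \<sigma>_def by (rule bij_betw_disjoint_Un[OF g h]) auto
  then have bij: "bij \<sigma>"
    by (simp add: Compl_partition)
  have \<sigma>: "\<sigma> i \<in> B \<longleftrightarrow> i \<in> A" for i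
    using bij_betwE[OF g] bij_betwE[OF h] by (auto simp: \<sigma>_def)
  \<comment> \<open>On \<open>A\<close> the slope is forced by sending the entry of
    \<open>v2\<close> to that of \<open>u2\<close>; off \<open>A\<close> each pair agrees and any
    nonzero slope would do.\<close>
  define a where "a i = (if i \<in> A then (u2 $ i - u1 $ i) / (v2 $ \<sigma> i - v1 $ \<sigma> i) else 1)" for i
  have a: "a i \<noteq> 0" for i
    using \<sigma>[of i] by (auto simp: a_def A_def B_def)
  define f where "f x = (\<chi> i. u1 $ i + a i * (x $ \<sigma> i - v1 $ \<sigma> i))" for x
  have "hamming_dist (f x) (f y) = hamming_dist x y" for x y
  proof -
    have "{i. f x $ i \<noteq> f y $ i} = \<sigma> -` {i. x $ i \<noteq> y $ i}"
      using a by (auto simp: f_def)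
    moreover have "card (\<sigma> -` {i. x $ i \<noteq> y $ i}) = card {i. x $ i \<noteq> y $ i}"
      using bij by (intro card_vimage_inj) (auto simp: bij_def)
    ultimately show ?thesis
      by (simp add: hamming_dist_def)
  qed
  moreover have "f v1 = u1"
    by (simp add: f_def vec_eq_iff)
  moreover have "f v2 = u2"
  proof (intro vec_eq_iff[THEN iffD2] allI)
    fix i
    show "f v2 $ i = u2 $ i"
      using \<sigma>[of i] by (auto simp: f_def a_def A_def B_def)
  qed
  ultimately show ?thesis by blast
qed


section \<open>The complement graph\<close>

abbreviation far_graph :: "nat \<Rightarrow> ('f::{field,finite} ^ 'n::finite) ugraph" where
  "far_graph d \<equiv> graph_complement (gen_hamming_graph d)"

lemma verts_far_graph [simp]: "verts (far_graph d) = UNIV"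
  by (simp add: graph_complement_def gen_hamming_graph_def)

text \<open>Positivity of \<open>d\<close> makes the right-hand side false for \<open>x = y\<close>,
  in accordance with the absence of loops.\<close>

lemma edges_far_graph:
  assumes "0 < d"
  shows "{x, y} \<in> edges (far_graph d) \<longleftrightarrow> d \<le> hamming_dist x y"
proof -
  have ham: "{x, y} \<in> edges (gen_hamming_graph d) \<longleftrightarrow> x \<noteq> y \<and> hamming_dist x y < d"
    for x y :: "('f::{field,finite}) ^ ('n::finite)"
    by (auto simp: gen_hamming_graph_def doubleton_eq_iff hamming_dist_commute)
  have "{x, y} \<in> edges (far_graph d) \<longleftrightarrow> x \<noteq> y \<and> {x, y} \<notin> edges (gen_hamming_graph d)"
    by (auto simp: graph_complement_def gen_hamming_graph_def doubleton_eq_iff insert_commute)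
  then show ?thesis
    using assms by (auto simp: ham not_less)
qed

lemma ex_edge_far_graph:
  assumes "e \<in> edges (far_graph d)"
  shows "\<exists>x y. e = {x, y}"
  using assms by (auto simp: graph_complement_def)

lemma automorphism_far_graph_iff:
  assumes "0 < d"
  shows "automorphism (far_graph d) f \<longleftrightarrow>
     bij f \<and> (\<forall>x y. d \<le> hamming_dist (f x) (f y) \<longleftrightarrow> d \<le> hamming_dist x y)"
  using assms by (simp add: automorphism_def edges_far_graph)

lemma automorphism_far_graphI:
  assumes "0 < d" and "inj f"
    and "\<And>x y. d \<le> hamming_dist (f x) (f y) \<longleftrightarrow> d \<le> hamming_dist x y"
  shows "automorphism (far_graph d) f"
  using assms by (simp add: automorphism_far_graph_iff bij_def finite_UNIV_inj_surj)

lemma automorphism_isometry: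
  assumes "0 < d" and iso: "\<And>x y. hamming_dist (f x) (f y) = hamming_dist x y"
  shows "automorphism (far_graph d) f"
proof (rule automorphism_far_graphI)
  show "inj f"
    by (rule injI) (metis iso hamming_dist_eq_0_iff)
qed (simp_all add: assms)

section \<open>Orbits of ordered vertex pairs\<close>

lemma automorphism_comp:
  assumes "0 < d" and "automorphism (far_graph d) f" and "automorphism (far_graph d) g"
  shows "automorphism (far_graph d) (g \<circ> f)"
  using assms by (auto simp: automorphism_far_graph_iff bij_comp)

lemma automorphism_inv:
  assumes "0 < d" and "automorphism (far_graph d) f"
  shows "automorphism (far_graph d) (inv f)"
  using assms by (auto simp: automorphism_far_graph_iff bij_imp_bij_inv)
    (metis bij_inv_eq_iff)+

text \<open>Ordered pairs suit distance-transitivity directly; edge-transitivity yields this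
  relation only up to a swap.\<close>

definition same_orbit ::
    "nat \<Rightarrow> 'f::{field,finite} ^ 'n::finite \<Rightarrow> 'f ^ 'n \<Rightarrow> 'f ^ 'n \<Rightarrow> 'f ^ 'n \<Rightarrow> bool" where
  "same_orbit d v1 v2 u1 u2 \<longleftrightarrow> (\<exists>f. automorphism (far_graph d) f \<and> f v1 = u1 \<and> f v2 = u2)"

lemma same_orbit_sym:
  assumes "0 < d" and "same_orbit d v1 v2 u1 u2"
  shows "same_orbit d u1 u2 v1 v2"
proof -
  obtain f where f: "automorphism (far_graph d) f" "f v1 = u1" "f v2 = u2"
    using assms(2) unfolding same_orbit_def by blast
  then have "inj f"
    using assms(1) by (simp add: automorphism_far_graph_iff bij_is_inj)
  then show ?thesis
    unfolding same_orbit_def using f automorphism_inv[OF assms(1) f(1)]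
    by (intro exI[of _ "inv f"]) auto
qed

lemma same_orbit_trans:
  assumes "0 < d" and "same_orbit d v1 v2 u1 u2" and "same_orbit d u1 u2 w1 w2"
  shows "same_orbit d v1 v2 w1 w2"
proof -
  obtain f g where "automorphism (far_graph d) f" "f v1 = u1" "f v2 = u2"
    "automorphism (far_graph d) g" "g u1 = w1" "g u2 = w2"
    using assms(2,3) unfolding same_orbit_def by blast
  then show ?thesis
    unfolding same_orbit_def using automorphism_comp[OF assms(1)]
    by (intro exI[of _ "g \<circ> f"]) auto
qed

lemma same_orbit_hamming:
  assumes "0 < d" and "hamming_dist v1 v2 = hamming_dist u1 u2"
  shows "same_orbit d v1 v2 u1 u2"
  unfolding same_orbit_def
  using ex_hamming_isometry[OF assms(2)] automorphism_isometry[OF assms(1)] by metis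

lemma distance_transitive_far_graph_iff:
  "distance_transitive (far_graph d :: ('f::{field,finite} ^ 'n::finite) ugraph) \<longleftrightarrow>
     (\<forall>u1 u2 v1 v2 :: 'f ^ 'n. graph_dist (far_graph d) v1 v2 = graph_dist (far_graph d) u1 u2 \<longrightarrow>
        same_orbit d v1 v2 u1 u2)"
  by (simp add: distance_transitive_def same_orbit_def)

lemma far_graph_dist_eq_0_iff: "graph_dist (far_graph d) u v = 0 \<longleftrightarrow> u = v"
  by (simp add: graph_dist_eq_0_iff)

lemma far_graph_dist_eq_1_iff:
  assumes "0 < d"
  shows "graph_dist (far_graph d) u v = 1 \<longleftrightarrow> d \<le> hamming_dist u v"
  using assms edges_far_graph[of d u u]
  by (subst graph_dist_eq_1_iff) (simp_all add: edges_far_graph)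

lemma edge_transitive_far_graphI:
  assumes "0 < d"
    and "\<And>u1 u2 v1 v2 :: 'f ^ 'n. d \<le> hamming_dist v1 v2 \<Longrightarrow> d \<le> hamming_dist u1 u2 \<Longrightarrow>
           same_orbit d v1 v2 u1 u2"
  shows "edge_transitive (far_graph d :: ('f::{field,finite} ^ 'n::finite) ugraph)"
  unfolding edge_transitive_def
proof (intro ballI)
  fix e1 e2 :: "('f ^ 'n) set"
  assume e: "e1 \<in> edges (far_graph d)" "e2 \<in> edges (far_graph d)"
  then obtain v1 v2 u1 u2 where eq: "e1 = {v1, v2}" "e2 = {u1, u2}"
    using ex_edge_far_graph by metis
  then have "same_orbit d v1 v2 u1 u2"
    using e assms by (simp add: edges_far_graph)
  then show "\<exists>f. automorphism (far_graph d) f \<and> f ` e1 = e2"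
    unfolding same_orbit_def eq by auto
qed

text \<open>Edges are the pairs at graph distance 1, so even their orientations can be
  prescribed.\<close>

lemma distance_transitive_imp_edge_transitive:
  assumes "0 < d" and "distance_transitive (far_graph d :: ('f::{field,finite} ^ 'n::finite) ugraph)"
  shows "edge_transitive (far_graph d :: ('f ^ 'n) ugraph)"
  using assms(1)
proof (rule edge_transitive_far_graphI)
  fix u1 u2 v1 v2 :: "'f ^ 'n"
  assume "d \<le> hamming_dist v1 v2" "d \<le> hamming_dist u1 u2"
  then have "graph_dist (far_graph d) v1 v2 = graph_dist (far_graph d) u1 u2"
    using far_graph_dist_eq_1_iff[OF assms(1)] by metis
  then show "same_orbit d v1 v2 u1 u2"
    using assms(2) by (simp add: distance_transitive_far_graph_iff)
qed

section \<open>Common neighbours\<close>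

definition common_neighbours ::
    "nat \<Rightarrow> 'f ^ 'n::finite \<Rightarrow> 'f ^ 'n \<Rightarrow> ('f ^ 'n) set" where
  "common_neighbours d x y = {z. d \<le> hamming_dist z x \<and> d \<le> hamming_dist z y}"

lemma common_neighbours_commute: "common_neighbours d x y = common_neighbours d y x"
  by (auto simp: common_neighbours_def)

lemma card_common_neighbours_automorphism:
  assumes "0 < d" and "automorphism (far_graph d) f"
  shows "card (common_neighbours d (f x) (f y)) = card (common_neighbours d x y)"
proof -
  have f: "bij f" "\<And>x y. d \<le> hamming_dist (f x) (f y) \<longleftrightarrow> d \<le> hamming_dist x y"
    using assms by (simp_all add: automorphism_far_graph_iff)
  have "f -` common_neighbours d (f x) (f y) = common_neighbours d x y"
    by (auto simp: common_neighbours_def f(2))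
  then show ?thesis
    using card_vimage_inj[of f "common_neighbours d (f x) (f y)"] f(1) by (simp add: bij_def)
qed

lemma card_common_neighbours_same_orbit:
  assumes "0 < d" and "same_orbit d v1 v2 u1 u2"
  shows "card (common_neighbours d v1 v2) = card (common_neighbours d u1 u2)"
  using assms(2) card_common_neighbours_automorphism[OF assms(1)]
  unfolding same_orbit_def by metis

text \<open>A common neighbour lost by moving \<open>y\<close> away from \<open>x\<close> at \<open>i\<close> agrees with \<open>x\<close> at \<open>i\<close>. Changing
  that coordinate injects the gained into the lost common neighbours, and \<open>v\<close> yields a lost one
  outside the image.\<close>

lemma card_common_neighbours_vupd:
  fixes x y :: "'f::finite ^ 'n::finite"
  assumes xy: "x $ i = y $ i" and b: "b \<noteq> x $ i"
  shows "card (common_neighbours d x (vupd y i b)) \<le> card (common_neighbours d x y)" (is ?le)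
    and "\<And>v. 0 < d \<Longrightarrow> v $ i = x $ i \<Longrightarrow> hamming_off i v x = d - 1 \<Longrightarrow> hamming_off i v y = d - 1 \<Longrightarrow>
      card (common_neighbours d x (vupd y i b)) < card (common_neighbours d x y)"
proof -
  define P where "P = common_neighbours d x y"
  define Q where "Q = common_neighbours d x (vupd y i b)"
  have P: "z \<in> P \<longleftrightarrow> d \<le> of_bool (z $ i \<noteq> x $ i) + hamming_off i z x \<and>
      d \<le> of_bool (z $ i \<noteq> x $ i) + hamming_off i z y" for z
    using xy by (simp add: P_def common_neighbours_def hamming_dist_split[of _ _ i])
  have Q: "z \<in> Q \<longleftrightarrow> d \<le> of_bool (z $ i \<noteq> x $ i) + hamming_off i z x \<and>
      d \<le> of_bool (z $ i \<noteq> b) + hamming_off i z y" for z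
    by (simp add: Q_def common_neighbours_def hamming_dist_split[of _ _ i])
  \<comment> \<open>A gained common neighbour must become farther from the moved point, which
    happens only if its entry at \<open>i\<close> is the old value \<open>x $ i\<close>.\<close>
  have agree: "z $ i = x $ i" if "z \<in> Q - P" for z
    using that by (auto simp: P Q of_bool_def split: if_splits)
  have inj: "inj_on (\<lambda>z. vupd z i b) (Q - P)"
  proof (rule inj_onI)
    fix z z'
    assume z: "z \<in> Q - P" "z' \<in> Q - P" "vupd z i b = vupd z' i b"
    have "z $ j = z' $ j" for j
      using arg_cong[OF z(3), of "\<lambda>w. w $ j"] agree[OF z(1)] agree[OF z(2)]
      by (cases "j = i") simp_all
    then show "z = z'"
      by (simp add: vec_eq_iff)
  qed
  \<comment> \<open>Off \<open>i\<close>, a gained \<open>z\<close> has distance at least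
    \<open>d\<close> from \<open>x\<close> and exactly \<open>d - 1\<close> from \<open>y\<close>.
    With entry \<open>b\<close> at \<open>i\<close> it therefore reaches \<open>d\<close> from
    \<open>y\<close> but not from \<open>vupd y i b\<close>.\<close>
  have sub: "(\<lambda>z. vupd z i b) ` (Q - P) \<subseteq> P - Q"
  proof
    fix w
    assume "w \<in> (\<lambda>z. vupd z i b) ` (Q - P)"
    then obtain z where z: "z \<in> Q - P" "w = vupd z i b"
      by blast
    then show "w \<in> P - Q"
      using b agree[OF z(1)] by (auto simp: P Q)
  qed
  have card_P: "card P = card (P \<inter> Q) + card (P - Q)"
    by (metis card_Int_Diff finite)
  have card_Q: "card Q = card (P \<inter> Q) + card (Q - P)"
    by (metis card_Int_Diff finite inf_commute)
  have card_diff: "card (Q - P) = card ((\<lambda>z. vupd z i b) ` (Q - P))"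
    by (simp add: card_image inj)
  have "card (Q - P) \<le> card (P - Q)"
    unfolding card_diff by (rule card_mono[OF _ sub]) simp
  then show ?le
    using card_P card_Q by (simp add: P_def Q_def)
  fix v
  assume v: "0 < d" "v $ i = x $ i" "hamming_off i v x = d - 1" "hamming_off i v y = d - 1"
  have "vupd v i b \<in> P - Q"
    using v b by (auto simp: P Q)
  \<comment> \<open>Vectors in the image keep distance at least \<open>d\<close> from
    \<open>x\<close> off \<open>i\<close>, while \<open>v\<close> has only
    \<open>d - 1\<close>.\<close>
  moreover have "vupd v i b \<notin> (\<lambda>z. vupd z i b) ` (Q - P)"
  proof
    assume "vupd v i b \<in> (\<lambda>z. vupd z i b) ` (Q - P)"
    then obtain z where z: "z \<in> Q - P" "vupd v i b = vupd z i b"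
      by blast
    then have "hamming_off i z x = d - 1"
      using v(3) by (metis hamming_off_vupd(1))
    then show False
      using z(1) agree[OF z(1)] v(1) by (auto simp: Q)
  qed
  ultimately have "(\<lambda>z. vupd z i b) ` (Q - P) \<subset> P - Q"
    using sub by blast
  then have "card (Q - P) < card (P - Q)"
    unfolding card_diff by (intro psubset_card_mono) auto
  then show "card (common_neighbours d x (vupd y i b)) < card (common_neighbours d x y)"
    using card_P card_Q by (simp add: P_def Q_def)
qed

lemma card_common_neighbours_cong:
  fixes x y x' y' :: "'f::{field,finite} ^ 'n::finite"
  assumes "0 < d" and "hamming_dist x y = hamming_dist x' y'"
  shows "card (common_neighbours d x y) = card (common_neighbours d x' y')"
  using card_common_neighbours_same_orbit same_orbit_hamming assms by blast

text \<open>Differing entries of \<open>y'\<close> are reset to those of \<open>x'\<close> one at a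
  time until the distance of \<open>x\<close> and \<open>y\<close> is reached; undoing a reset never
  increases the count.\<close>

lemma card_common_neighbours_antimono:
  fixes x y x' y' :: "'f::{field,finite} ^ 'n::finite"
  assumes "0 < d" and "hamming_dist x y \<le> hamming_dist x' y'"
  shows "card (common_neighbours d x' y') \<le> card (common_neighbours d x y)"
  using assms(2)
proof (induction "hamming_dist x' y' - hamming_dist x y" arbitrary: y')
  case 0
  then show ?case
    using card_common_neighbours_cong[OF assms(1), of x y x' y'] by simp
next
  case (Suc m)
  then have "hamming_dist x' y' \<noteq> 0"
    by linarith
  then obtain i where i: "x' $ i \<noteq> y' $ i"
    by (auto simp: vec_eq_iff)
  define z where "z = vupd y' i (x' $ i)"
  have y': "y' = vupd z i (y' $ i)"
    by (simp add: z_def vec_eq_iff)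
  have "hamming_dist x' y' = Suc (hamming_dist x' z)"
    using i by (simp add: z_def hamming_dist_split[of x' _ i])
  then have "card (common_neighbours d x' z) \<le> card (common_neighbours d x y)"
    using Suc by (intro Suc.hyps(1)) auto
  moreover have "card (common_neighbours d x' y') \<le> card (common_neighbours d x' z)"
    using i by (subst y', intro card_common_neighbours_vupd(1)) (auto simp: z_def)
  ultimately show ?case by simp
qed

text \<open>The witness \<open>v\<close> of \<open>card_common_neighbours_vupd\<close> is described by the set \<open>X\<close> of positions
  where it differs from \<open>x\<close> and the set \<open>Y\<close> where it differs from \<open>y\<close>.\<close>

lemma card_common_neighbours_less:
  fixes x y x' y' :: "'f::{field,finite} ^ 'n::finite"
  assumes d: "0 < d" and next_dist: "hamming_dist x' y' = Suc (hamming_dist x y)"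
    and XY: "i \<notin> X" "i \<notin> Y" "card X = d - 1" "card Y = d - 1"
    and agree: "x $ i = y $ i"
    and cover: "{j. x $ j \<noteq> y $ j} \<subseteq> X \<union> Y" "X - Y \<union> (Y - X) \<subseteq> {j. x $ j \<noteq> y $ j}"
    and third: "\<And>j. j \<in> X \<inter> Y \<Longrightarrow> \<exists>a. a \<noteq> x $ j \<and> a \<noteq> y $ j"
  shows "card (common_neighbours d x' y') < card (common_neighbours d x y)"
proof -
  obtain c where c: "\<And>j. j \<in> X \<inter> Y \<Longrightarrow> c j \<noteq> x $ j \<and> c j \<noteq> y $ j"
    using third by metis
  \<comment> \<open>Outside \<open>X\<close> the entry is that of \<open>x\<close>, outside
    \<open>Y\<close> that of \<open>y\<close>. By \<open>cover\<close> the two agree outside both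
    sets and differ on the symmetric difference.\<close>
  define v where "v = (\<chi> j. if j \<in> X \<inter> Y then c j else if j \<in> X then y $ j else x $ j)"
  have vx: "v $ j \<noteq> x $ j \<longleftrightarrow> j \<in> X" and vy: "v $ j \<noteq> y $ j \<longleftrightarrow> j \<in> Y" for j
    using c[of j] cover by (auto simp: v_def)
  have "{j. j \<noteq> i \<and> v $ j \<noteq> x $ j} = X" "{j. j \<noteq> i \<and> v $ j \<noteq> y $ j} = Y"
    using XY(1,2) by (auto simp: vx vy)
  then have off: "hamming_off i v x = d - 1" "hamming_off i v y = d - 1"
    using XY(3,4) by (simp_all add: hamming_off_def)
  have vi: "v $ i = x $ i"
    using vx[of i] XY(1) by blast
  have b: "x $ i + 1 \<noteq> x $ i"
    by simp
  have "hamming_dist x (vupd y i (x $ i + 1)) = Suc (hamming_dist x y)"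
    using agree by (simp add: hamming_dist_split[of x _ i])
  then have "card (common_neighbours d x' y') =
      card (common_neighbours d x (vupd y i (x $ i + 1)))"
    using next_dist by (intro card_common_neighbours_cong d) simp
  also have "\<dots> < card (common_neighbours d x y)"
    by (rule card_common_neighbours_vupd(2)[OF agree b d vi off])
  finally show ?thesis .
qed

section \<open>Strict drops in the number of common neighbours\<close>

lemma ex_third_element:
  fixes a b :: "'f::finite"
  assumes "3 \<le> CARD('f)"
  shows "\<exists>c. c \<noteq> a \<and> c \<noteq> b"
proof (rule ccontr)
  assume "\<not> ?thesis"
  then have "UNIV \<subseteq> {a, b}"
    by blast
  then have "CARD('f) \<le> card {a, b}"
    by (intro card_mono) auto
  also have "\<dots> \<le> 2"
    by (simp add: card_insert_if)
  finally show False
    using assms by simp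
qed

text \<open>The witness differs from \<open>x\<close> at \<open>j\<close>, from \<open>y\<close> at
  \<open>k\<close>, and from both on a set \<open>B\<close> of \<open>d - 2\<close> positions where
  they agree, so two field elements suffice. Room for \<open>B\<close> and a free position
  \<open>i\<close> outside \<open>{j, k}\<close> comes from \<open>d < n\<close>.\<close>

lemma card_common_neighbours_2_3:
  fixes x y x' y' :: "'f::{field,finite} ^ 'n::finite"
  assumes d: "2 \<le> d" "d < CARD('n)"
    and xy: "hamming_dist x y = 2" "hamming_dist x' y' = 3"
  shows "card (common_neighbours d x' y') < card (common_neighbours d x y)"
proof -
  define S where "S = {i. x $ i \<noteq> y $ i}"
  have S2: "card S = 2"
    using xy(1) by (simp add: S_def hamming_dist_def)
  then obtain j k where jk: "S = {j, k}" "j \<noteq> k"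
    by (auto simp: card_2_iff)
  have "card (- S) = CARD('n) - 2"
    using S2 by (simp add: Compl_eq_Diff_UNIV card_Diff_subset)
  then have "Suc (d - 2) \<le> card (- S)"
    using d by simp
  then obtain T where T: "T \<subseteq> - S" "card T = Suc (d - 2)"
    by (rule obtain_subset_with_card_n)
  then obtain i B where B: "T = insert i B" "i \<notin> B" "card B = d - 2"
    by (metis card_Suc_eq)
  have notin: "i \<notin> S" "j \<notin> B" "k \<notin> B" "B \<inter> S = {}"
    using T B jk by auto
  show ?thesis
  proof (rule card_common_neighbours_less[where X = "insert j B" and Y = "insert k B" and i = i])
    show "\<exists>a. a \<noteq> x $ l \<and> a \<noteq> y $ l" if "l \<in> insert j B \<inter> insert k B" for l
    proof -
      have "l \<notin> S"
        using that jk notin by auto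
      then have "x $ l = y $ l"
        by (simp add: S_def)
      then show ?thesis
        by (intro exI[of _ "x $ l + 1"]) simp
    qed
    show "0 < d" "hamming_dist x' y' = Suc (hamming_dist x y)"
      using d xy by simp_all
    show "i \<notin> insert j B" "i \<notin> insert k B"
      using notin(1) B(2) jk by auto
    show "x $ i = y $ i"
      using notin(1) by (simp add: S_def)
    show "card (insert j B) = d - 1" "card (insert k B) = d - 1"
      using B(3) notin(2,3) d(1) by simp_all
    show "{l. x $ l \<noteq> y $ l} \<subseteq> insert j B \<union> insert k B"
      "insert j B - insert k B \<union> (insert k B - insert j B) \<subseteq> {l. x $ l \<noteq> y $ l}"
      unfolding S_def[symmetric] using jk by auto
  qed
qed

text \<open>On the \<open>d\<close> differing positions the witness agrees with \<open>x\<close> at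
  \<open>j\<close>, with \<open>y\<close> at \<open>k\<close>, and takes a third value elsewhere;
  this is where three field elements enter.\<close>

lemma card_common_neighbours_d_Suc_d:
  fixes x y x' y' :: "'f::{field,finite} ^ 'n::finite"
  assumes q: "3 \<le> CARD('f)" and d: "2 \<le> d" "d < CARD('n)"
    and xy: "hamming_dist x y = d" "hamming_dist x' y' = Suc d"
  shows "card (common_neighbours d x' y') < card (common_neighbours d x y)"
proof -
  define S where "S = {i. x $ i \<noteq> y $ i}"
  have Sd: "card S = d"
    using xy(1) by (simp add: S_def hamming_dist_def)
  then have "S \<noteq> UNIV"
    using d by auto
  then obtain i where i: "i \<notin> S"
    by auto
  obtain T where T: "T \<subseteq> S" "card T = 2"
    using obtain_subset_with_card_n[of 2 S] Sd d by auto
  then obtain j k where jk: "j \<in> S" "k \<in> S" "j \<noteq> k"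
    by (auto simp: card_2_iff)
  show ?thesis
  proof (rule card_common_neighbours_less[where X = "S - {j}" and Y = "S - {k}" and i = i])
    show "0 < d" "hamming_dist x' y' = Suc (hamming_dist x y)"
      using d xy by simp_all
    show "i \<notin> S - {j}" "i \<notin> S - {k}" "x $ i = y $ i"
      using i by (auto simp: S_def)
    show "card (S - {j}) = d - 1" "card (S - {k}) = d - 1"
      using jk Sd by simp_all
    show "{l. x $ l \<noteq> y $ l} \<subseteq> S - {j} \<union> (S - {k})"
      "S - {j} - (S - {k}) \<union> (S - {k} - (S - {j})) \<subseteq> {l. x $ l \<noteq> y $ l}"
      unfolding S_def[symmetric] using jk by auto
  qed (rule ex_third_element[OF q])
qed

text \<open>The witness agrees with \<open>x\<close> and \<open>y\<close> at \<open>i\<close> and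
  avoids both everywhere else, which takes a third value at the differing position.\<close>

lemma card_common_neighbours_1_2:
  fixes x y x' y' :: "'f::{field,finite} ^ 'n::finite"
  assumes q: "3 \<le> CARD('f)" and n: "2 \<le> CARD('n)"
    and xy: "hamming_dist x y = 1" "hamming_dist x' y' = 2"
  shows "card (common_neighbours CARD('n) x' y') < card (common_neighbours CARD('n) x y)"
proof -
  have "card {i. x $ i \<noteq> y $ i} = 1"
    using xy(1) by (simp add: hamming_dist_def)
  then have "{i. x $ i \<noteq> y $ i} \<noteq> UNIV"
    using n by auto
  then obtain i where i: "x $ i = y $ i"
    by auto
  show ?thesis
  proof (rule card_common_neighbours_less[where X = "- {i}" and Y = "- {i}" and i = i])
    show "card (- {i}) = CARD('n) - 1" "card (- {i}) = CARD('n) - 1"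
      by (simp_all add: Compl_eq_Diff_UNIV card_Diff_subset)
  qed (use q n xy i in \<open>auto intro: ex_third_element\<close>)
qed


section \<open>Graphs that are not edge-transitive\<close>

lemma edge_transitiveD:
  fixes x y x' y' :: "'f::{field,finite} ^ 'n::finite"
  assumes "0 < d" and "edge_transitive (far_graph d :: ('f ^ 'n) ugraph)"
    and "d \<le> hamming_dist x y" and "d \<le> hamming_dist x' y'"
  shows "same_orbit d x y x' y' \<or> same_orbit d x y y' x'"
proof -
  have "{x, y} \<in> edges (far_graph d)" "{x', y'} \<in> edges (far_graph d)"
    using assms by (simp_all add: edges_far_graph)
  then obtain f where "automorphism (far_graph d) f" "f ` {x, y} = {x', y'}"
    using assms(2) unfolding edge_transitive_def by blast
  then show ?thesis
    unfolding same_orbit_def by (auto simp: doubleton_eq_iff)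
qed

lemma not_edge_transitive_q_ge_3:
  assumes q: "3 \<le> CARD('f)" and d: "2 \<le> d" "d < CARD('n)"
  shows "\<not> edge_transitive (far_graph d :: ('f::{field,finite} ^ 'n::finite) ugraph)"
proof
  assume et: "edge_transitive (far_graph d :: ('f ^ 'n) ugraph)"
  obtain y z :: "'f ^ 'n" where yz: "hamming_dist 0 y = d" "hamming_dist 0 z = Suc d"
    using ex_hamming_dist[of d "0 :: 'f ^ 'n"] ex_hamming_dist[of "Suc d" "0 :: 'f ^ 'n"] d by auto
  then have "same_orbit d 0 y 0 z \<or> same_orbit d 0 y z 0"
    using d by (intro edge_transitiveD[OF _ et]) auto
  then have "card (common_neighbours d 0 y) = card (common_neighbours d 0 z)"
    using card_common_neighbours_same_orbit[of d 0 y 0 z] card_common_neighbours_same_orbit[of d 0 y z 0]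
      common_neighbours_commute[of d z 0] d by auto
  then show False
    using card_common_neighbours_d_Suc_d[OF q d yz] by simp
qed

text \<open>Being at Hamming distance at most 2 means having many common neighbours, so automorphisms
  preserve this relation, and hence being at distance at most \<open>2 * k\<close>.\<close>

lemma automorphism_hamming_dist_le_2k:
  fixes x y :: "'f::{field,finite} ^ 'n::finite"
  assumes d: "2 \<le> d" "d < CARD('n)" and f: "automorphism (far_graph d) f"
    and "hamming_dist x y \<le> 2 * k"
  shows "hamming_dist (f x) (f y) \<le> 2 * k"
  using assms(4)
proof (induction k arbitrary: y)
  case 0
  then show ?case by simp
next
  case (Suc k)
  have step: "hamming_dist (f a) (f b) \<le> 2" if ab: "hamming_dist a b \<le> 2" for a b
  proof (rule ccontr)
    assume "\<not> hamming_dist (f a) (f b) \<le> 2"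
    then have far: "3 \<le> hamming_dist (f a) (f b)"
      by simp
    \<comment> \<open>Distance 3 occurs because \<open>2 \<le> d\<close> and \<open>d < n\<close>
      force at least three coordinates.\<close>
    obtain y2 y3 :: "'f ^ 'n" where y: "hamming_dist 0 y2 = 2" "hamming_dist 0 y3 = 3"
      using ex_hamming_dist[of 2 "0 :: 'f ^ 'n"] ex_hamming_dist[of 3 "0 :: 'f ^ 'n"] d by auto
    have "card (common_neighbours d (f a) (f b)) \<le> card (common_neighbours d 0 y3)"
      using d far y by (intro card_common_neighbours_antimono) auto
    also have "\<dots> < card (common_neighbours d 0 y2)"
      by (rule card_common_neighbours_2_3[OF d y])
    also have "\<dots> \<le> card (common_neighbours d a b)"
      using d ab y by (intro card_common_neighbours_antimono) auto
    also have "\<dots> = card (common_neighbours d (f a) (f b))"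
      using d f by (subst card_common_neighbours_automorphism) auto
    finally show False by simp
  qed
  \<comment> \<open>The minimum and the truncated subtraction also cover distances below
    \<open>2 * k\<close>, where \<open>z\<close> is \<open>y\<close> itself.\<close>
  have "hamming_dist x y = min (2 * k) (hamming_dist x y) + (hamming_dist x y - 2 * k)"
    by simp
  from hamming_dist_between[OF this] obtain z where
    "hamming_dist x z = min (2 * k) (hamming_dist x y)"
    "hamming_dist z y = hamming_dist x y - 2 * k"
    by blast
  then have z: "hamming_dist x z \<le> 2 * k" "hamming_dist z y \<le> 2"
    using Suc.prems by simp_all
  have "hamming_dist (f x) (f y) \<le> hamming_dist (f x) (f z) + hamming_dist (f z) (f y)"
    by (rule hamming_dist_triangle)
  also have "\<dots> \<le> 2 * k + 2"
    using Suc.IH[OF z(1)] step[OF z(2)] by simp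
  finally show ?case by simp
qed

text \<open>Distances \<open>d\<close> and \<open>n\<close> both give edges, but only the first is
  at most \<open>2 * k\<close>, a bound that automorphisms preserve.\<close>

lemma not_edge_transitive_parity:
  assumes d: "2 \<le> d" and k: "d \<le> 2 * k" "2 * k < CARD('n)"
  shows "\<not> edge_transitive (far_graph d :: ('f::{field,finite} ^ 'n::finite) ugraph)"
proof
  assume et: "edge_transitive (far_graph d :: ('f ^ 'n) ugraph)"
  obtain y z :: "'f ^ 'n" where yz: "hamming_dist 0 y = d" "hamming_dist 0 z = CARD('n)"
    using ex_hamming_dist[of d "0 :: 'f ^ 'n"] ex_hamming_dist[of "CARD('n)" "0 :: 'f ^ 'n"] k by auto
  then have "same_orbit d 0 y 0 z \<or> same_orbit d 0 y z 0"
    using d k by (intro edge_transitiveD[OF _ et]) auto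
  then obtain f where f: "automorphism (far_graph d) f"
    and "f 0 = 0 \<and> f y = z \<or> f 0 = z \<and> f y = 0"
    unfolding same_orbit_def by blast
  then have "hamming_dist (f 0) (f y) = CARD('n)"
    using yz(2) hamming_dist_commute[of z 0] by auto
  moreover have "hamming_dist (f 0) (f y) \<le> 2 * k"
    using d k yz by (intro automorphism_hamming_dist_le_2k[OF _ _ f]) auto
  ultimately show False
    using k by simp
qed

section \<open>Distance-transitive cases\<close>

lemma CARD_2_cases:
  fixes x :: "'f::{field,finite}"
  assumes "CARD('f) = 2"
  shows "x = 0 \<or> x = 1"
proof -
  have "{0, 1 :: 'f} = UNIV"
    using assms by (intro card_subset_eq) auto
  then show ?thesis by blast
qed

lemma CARD_2_add_self:
  fixes x :: "'f::{field,finite}"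
  assumes "CARD('f) = 2"
  shows "x + x = 0"
proof -
  have "1 + 1 = (0 :: 'f)"
    using CARD_2_cases[OF assms, of "1 + 1"] by (metis add_cancel_right_right zero_neq_one)
  then show ?thesis
    using CARD_2_cases[OF assms, of x] by auto
qed

lemma CARD_2_neq_iff:
  fixes x y :: "'f::{field,finite}"
  assumes "CARD('f) = 2"
  shows "x \<noteq> y + 1 \<longleftrightarrow> x = y"
  using CARD_2_cases[OF assms, of x] CARD_2_cases[OF assms, of y] CARD_2_add_self[OF assms, of 1]
  by auto

text \<open>Over the two-element field this is the complementary word, the only vector at distance
  \<open>n\<close> from \<open>x\<close>.\<close>

definition antipode :: "'f::{plus,one} ^ 'n \<Rightarrow> 'f ^ 'n" where
  "antipode x = (\<chi> i. x $ i + 1)"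

lemma hamming_dist_antipode:
  fixes x y :: "'f::{field,finite} ^ 'n::finite"
  assumes q: "CARD('f) = 2"
  shows "hamming_dist x (antipode y) + hamming_dist x y = CARD('n)"
proof -
  have "{i. x $ i \<noteq> antipode y $ i} = - {i. x $ i \<noteq> y $ i}"
    using CARD_2_neq_iff[OF q] by (auto simp: antipode_def)
  moreover have "card {i. x $ i \<noteq> y $ i} \<le> CARD('n)"
    by (rule card_mono) auto
  ultimately show ?thesis
    by (simp add: hamming_dist_def Compl_eq_Diff_UNIV card_Diff_subset)
qed

lemma CARD_le_hamming_dist_iff:
  fixes x y :: "'f::{field,finite} ^ 'n::finite"
  assumes q: "CARD('f) = 2"
  shows "CARD('n) \<le> hamming_dist x y \<longleftrightarrow> x = antipode y"
  using hamming_dist_antipode[OF q, of x y] hamming_dist_eq_0_iff[of x "antipode y"] by linarith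

lemma antipode_antipode:
  fixes x :: "'f::{field,finite} ^ 'n::finite"
  assumes q: "CARD('f) = 2"
  shows "antipode (antipode x) = x"
  using CARD_2_add_self[OF q, of 1] by (simp add: antipode_def vec_eq_iff add.assoc)

lemma antipode_neq: "antipode x \<noteq> (x :: 'f::{field,finite} ^ 'n::finite)"
  by (simp add: antipode_def vec_eq_iff)

text \<open>For \<open>q = 2\<close> and \<open>d = n\<close> the edges join each vector to its
  antipode, so every permutation commuting with \<open>antipode\<close> is an automorphism. A
  translation takes \<open>v1\<close> to \<open>u1\<close>; a swap of two antipodal pairs then
  corrects the second point.\<close>

lemma same_orbit_perfect_matching:
  fixes u1 u2 v1 v2 :: "'f::{field,finite} ^ 'n::finite"
  assumes q: "CARD('f) = 2"
    and v: "v1 \<noteq> v2" "hamming_dist v1 v2 < CARD('n)"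
    and u: "u1 \<noteq> u2" "hamming_dist u1 u2 < CARD('n)"
  shows "same_orbit CARD('n) v1 v2 u1 u2"
proof -
  note anti = antipode_antipode[OF q, where 'n = 'n] antipode_neq[where 'f = 'f and 'n = 'n]
  define t where "t x = x + (u1 - v1)" for x :: "'f ^ 'n"
  have iso: "hamming_dist (t x) (t y) = hamming_dist x y" for x y
    by (simp add: t_def hamming_dist_def)
  define w where "w = t v2"
  have w: "hamming_dist u1 w = hamming_dist v1 v2"
    using iso[of v1 v2] by (simp add: w_def t_def)
  then have "same_orbit CARD('n) v1 v2 u1 w"
    by (intro same_orbit_hamming) simp_all
  moreover have "same_orbit CARD('n) u1 w u1 u2"
  proof -
    \<comment> \<open>Exchanges the antipodal pairs of \<open>w\<close> and \<open>u2\<close>;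
      \<open>u1\<close> lies in neither and stays fixed.\<close>
    define h where "h z =
      (if z = w then u2 else if z = u2 then w
       else if z = antipode w then antipode u2 else if z = antipode u2 then antipode w else z)" for z
    have hh: "h (h z) = z" for z
      unfolding h_def using anti by (smt (verit))
    have ha: "h (antipode z) = antipode (h z)" for z
      unfolding h_def using anti by (smt (verit))
    have inj: "inj h"
      by (metis hh injI)
    have "automorphism (far_graph CARD('n)) h"
    proof (rule automorphism_far_graphI[OF _ inj])
      show "CARD('n) \<le> hamming_dist (h x) (h y) \<longleftrightarrow> CARD('n) \<le> hamming_dist x y" for x y
        using inj by (simp add: CARD_le_hamming_dist_iff[OF q] inj_eq flip: ha)
    qed simp
    moreover have "w \<noteq> u1"
      using w v(1) by (metis hamming_dist_eq_0_iff)
    moreover have "u1 \<noteq> antipode w" "u1 \<noteq> antipode u2"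
      using w v(2) u(2) CARD_le_hamming_dist_iff[OF q] by (metis linorder_not_le)+
    ultimately show ?thesis
      unfolding same_orbit_def using u(1) by (intro exI[of _ h]) (auto simp: h_def)
  qed
  ultimately show ?thesis
    by (rule same_orbit_trans[rotated]) simp
qed

section \<open>The extreme case \<open>d = n\<close>\<close>

lemma graph_dist_d_eq_n_eq_1_iff:
  fixes u v :: "'f::{field,finite} ^ 'n::finite"
  shows "graph_dist (far_graph CARD('n)) u v = 1 \<longleftrightarrow> hamming_dist u v = CARD('n)"
  using far_graph_dist_eq_1_iff[of "CARD('n)" u v] hamming_dist_le_CARD[of u v] by auto

lemma edge_transitive_d_eq_n:
  "edge_transitive (far_graph CARD('n) :: ('f::{field,finite} ^ 'n::finite) ugraph)"
proof (rule edge_transitive_far_graphI)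
  fix u1 u2 v1 v2 :: "'f ^ 'n"
  assume "CARD('n) \<le> hamming_dist v1 v2" "CARD('n) \<le> hamming_dist u1 u2"
  then have "hamming_dist v1 v2 = hamming_dist u1 u2"
    using hamming_dist_le_CARD[of v1 v2] hamming_dist_le_CARD[of u1 u2] by linarith
  then show "same_orbit CARD('n) v1 v2 u1 u2"
    by (rule same_orbit_hamming[rotated]) simp
qed simp

text \<open>Graph distances 0 and 1 determine the Hamming distances 0 and \<open>n\<close>. In
  between, \<open>n = 2\<close> leaves a single value, and \<open>q = 2\<close> a single
  orbit.\<close>

lemma distance_transitive_d_eq_n:
  assumes "CARD('f) = 2 \<or> CARD('n) = 2"
  shows "distance_transitive (far_graph CARD('n) :: ('f::{field,finite} ^ 'n::finite) ugraph)"
  unfolding distance_transitive_far_graph_iff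
proof (intro allI impI)
  fix u1 u2 v1 v2 :: "'f ^ 'n"
  assume eq: "graph_dist (far_graph CARD('n)) v1 v2 = graph_dist (far_graph CARD('n)) u1 u2"
  have zero: "v1 = v2 \<longleftrightarrow> u1 = u2"
    using eq far_graph_dist_eq_0_iff by metis
  have adj: "hamming_dist v1 v2 = CARD('n) \<longleftrightarrow> hamming_dist u1 u2 = CARD('n)"
    using eq graph_dist_d_eq_n_eq_1_iff by metis
  have le: "hamming_dist v1 v2 \<le> CARD('n)" "hamming_dist u1 u2 \<le> CARD('n)"
    by (rule hamming_dist_le_CARD)+
  show "same_orbit CARD('n) v1 v2 u1 u2"
  proof (cases "hamming_dist v1 v2 = hamming_dist u1 u2")
    case True
    then show ?thesis
      by (intro same_orbit_hamming) simp_all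
  next
    case False
    then have ne: "v1 \<noteq> v2" "u1 \<noteq> u2"
      using zero by auto
    then have "hamming_dist v1 v2 \<noteq> 0" "hamming_dist u1 u2 \<noteq> 0"
      by simp_all
    then have "CARD('n) \<noteq> 2" "hamming_dist v1 v2 < CARD('n)" "hamming_dist u1 u2 < CARD('n)"
      using False adj le by linarith+
    then show ?thesis
      using assms ne by (intro same_orbit_perfect_matching) auto
  qed
qed

lemma not_distance_transitive_d_eq_n:
  assumes q: "3 \<le> CARD('f)" and n: "3 \<le> CARD('n)"
  shows "\<not> distance_transitive (far_graph CARD('n) :: ('f::{field,finite} ^ 'n::finite) ugraph)"
proof
  assume dt: "distance_transitive (far_graph CARD('n) :: ('f ^ 'n) ugraph)"
  obtain y z :: "'f ^ 'n" where yz: "hamming_dist 0 y = 1" "hamming_dist 0 z = 2"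
    using ex_hamming_dist[of 1 "0 :: 'f ^ 'n"] ex_hamming_dist[of 2 "0 :: 'f ^ 'n"] n by auto
  have dist2: "graph_dist (far_graph CARD('n)) 0 x = enat 2"
    if x: "hamming_dist 0 x \<in> {1, 2}" for x :: "'f ^ 'n"
  proof -
    \<comment> \<open>A vector avoiding both \<open>0\<close> and \<open>x\<close> in every
      coordinate is a common neighbour of them.\<close>
    have "\<forall>i. \<exists>a. a \<noteq> 0 \<and> a \<noteq> x $ i"
      using ex_third_element[OF q] by blast
    then obtain c where c: "\<And>i. c i \<noteq> 0 \<and> c i \<noteq> x $ i"
      by metis
    have "{i. (0 :: 'f ^ 'n) $ i \<noteq> vec_lambda c $ i} = UNIV" "{i. vec_lambda c $ i \<noteq> x $ i} = UNIV"
      using c by (auto simp: eq_commute[of 0])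
    then have "hamming_dist 0 (vec_lambda c) = CARD('n)" "hamming_dist (vec_lambda c) x = CARD('n)"
      unfolding hamming_dist_def by simp_all
    then show ?thesis
      using x n by (intro graph_dist_eq_2I[where w = "vec_lambda c"]) (auto simp: edges_far_graph)
  qed
  have "same_orbit CARD('n) 0 y 0 z"
    using dt dist2[of y] dist2[of z] yz by (simp add: distance_transitive_far_graph_iff)
  then have "card (common_neighbours CARD('n) 0 y) = card (common_neighbours CARD('n) 0 z)"
    by (intro card_common_neighbours_same_orbit) simp_all
  then show False
    using card_common_neighbours_1_2[OF q _ yz] n by simp
qed


section \<open>The folded cube\<close>

text \<open>For \<open>q = 2\<close>, even \<open>n\<close> and \<open>d = n - 1\<close>, the graph is the folded \<open>(n + 1)\<close>-cube: it is the
  Cayley graph of \<open>n + 1\<close> vectors (all ones, and all ones but one) that span and have sum zero.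
  A vector of weight \<open>2 * j - 1\<close> or \<open>2 * j\<close> is a sum of \<open>2 * j\<close> or of \<open>n + 1 - 2 * j\<close> of these.\<close>

definition folded_dist :: "nat \<Rightarrow> nat \<Rightarrow> nat" where
  "folded_dist n w = min (2 * ((w + 1) div 2)) (n + 1 - 2 * ((w + 1) div 2))"

lemma half_Suc_bounds:
  fixes w :: nat
  shows "2 * ((w + 1) div 2) \<le> w + 1" and "w \<le> 2 * ((w + 1) div 2)"
  by simp_all

text \<open>For even \<open>n\<close>, rounding \<open>w\<close> up to an even number stays at most
  \<open>n\<close>, so the second argument of the minimum is positive.\<close>

lemma folded_dist_eq_0_iff:
  assumes "even n" and "w \<le> n"
  shows "folded_dist n w = 0 \<longleftrightarrow> w = 0"
proof -
  have "2 * ((w + 1) div 2) \<le> n"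
    using assms by presburger
  then show ?thesis
    using half_Suc_bounds[of w] by (auto simp: folded_dist_def min_def)
qed

text \<open>With \<open>w + w'\<close> within one of \<open>n\<close>, the halves of \<open>w\<close> and \<open>w'\<close> add up to \<open>n div 2\<close> or to
  \<open>n div 2 + 1\<close>, so each argument of the minimum differs by one from the other argument of the
  other minimum.\<close>

lemma folded_dist_lipschitz:
  assumes "even n" and "w \<le> n" and "n \<le> w + w' + 1" and "w + w' \<le> n + 1"
  shows "folded_dist n w' \<le> Suc (folded_dist n w)"
proof -
  obtain m where m: "n = 2 * m"
    using assms(1) by blast
  define j where "j = (w + 1) div 2"
  define j' where "j' = (w' + 1) div 2"
  have "2 * j \<le> w + 1" "w \<le> 2 * j" "2 * j' \<le> w' + 1" "w' \<le> 2 * j'"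
    unfolding j_def j'_def by (rule half_Suc_bounds)+
  then have "j \<le> m" "j + j' = m \<or> j + j' = m + 1"
    using assms m by linarith+
  then show ?thesis
    unfolding folded_dist_def j_def[symmetric] j'_def[symmetric] m by (auto simp: min_def)
qed

lemma folded_dist_descent:
  assumes "even n" and "w \<le> n" and "w \<noteq> 0"
  shows "\<exists>w'\<le>n. n \<le> w + w' + 1 \<and> w + w' \<le> n + 1 \<and> Suc (folded_dist n w') = folded_dist n w"
proof -
  obtain m where m: "n = 2 * m"
    using assms(1) by blast
  define j where "j = (w + 1) div 2"
  have j: "2 * j \<le> w + 1" "w \<le> 2 * j"
    unfolding j_def by (rule half_Suc_bounds)+
  then have jm: "j \<le> m" "0 < j"
    using assms m by linarith+
  show ?thesis
  proof (cases "2 * j \<le> n + 1 - 2 * j")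
    case True
    \<comment> \<open>With \<open>n + 1 - w\<close> the half becomes \<open>m + 1 - j\<close>, and
      the second argument of its minimum is \<open>2 * j - 1\<close>.\<close>
    have "n + 1 - w + 1 = 2 * (m + 1 - j) \<or> n + 1 - w + 1 = 2 * (m + 1 - j) + 1"
      using j jm m by linarith
    then have "(n + 1 - w + 1) div 2 = m + 1 - j"
      by auto
    then have "Suc (folded_dist n (n + 1 - w)) = folded_dist n w"
      unfolding folded_dist_def j_def[symmetric] using True jm m by (auto simp: min_def)
    then show ?thesis
      using assms by (intro exI[of _ "n + 1 - w"] conjI) linarith+
  next
    case False
    \<comment> \<open>With \<open>n - 1 - w\<close> the half becomes \<open>m - j\<close>, and the
      first argument of its minimum is \<open>n - 2 * j\<close>. For \<open>w = n\<close> truncation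
      gives weight 0, which still fits.\<close>
    have "n - 1 - w + 1 = 2 * (m - j) \<or> n - 1 - w + 1 = 2 * (m - j) + 1"
      using j jm m by linarith
    then have "(n - 1 - w + 1) div 2 = m - j"
      by auto
    then have "Suc (folded_dist n (n - 1 - w)) = folded_dist n w"
      unfolding folded_dist_def j_def[symmetric] using False jm m by (auto simp: min_def)
    then show ?thesis
      using assms by (intro exI[of _ "n - 1 - w"] conjI) linarith+
  qed
qed

text \<open>For even \<open>n\<close> the two arguments of the minimum have opposite parity, so its
  value reveals which one attains it.\<close>

lemma folded_dist_inj:
  assumes "even n" and "w \<le> n" and "w' \<le> n" and eq: "folded_dist n w = folded_dist n w'"
  shows "(w + 1) div 2 = (w' + 1) div 2"
proof -
  obtain m where m: "n = 2 * m"
    using assms(1) by blast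
  define j where "j = (w + 1) div 2"
  define j' where "j' = (w' + 1) div 2"
  have "2 * j \<le> w + 1" "2 * j' \<le> w' + 1"
    unfolding j_def j'_def by (rule half_Suc_bounds)+
  then have "j \<le> m" "j' \<le> m"
    using assms m by linarith+
  moreover have "min (2 * j) (2 * m + 1 - 2 * j) = min (2 * j') (2 * m + 1 - 2 * j')"
    using eq by (simp add: folded_dist_def j_def j'_def m)
  ultimately have "j = j'"
    unfolding min_def by (auto split: if_splits) presburger+
  then show ?thesis
    by (simp add: j_def j'_def)
qed

text \<open>Changing one coordinate of \<open>c\<close> moves it one step towards \<open>u\<close>
  or away from it; the latter needs a position of agreement, which \<open>k \<le> CARD('n)\<close>
  ensures.\<close>

lemma ex_hamming_step:
  fixes u c :: "'f::field ^ 'n::finite"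
  assumes "k \<le> CARD('n)" and "k \<le> hamming_dist u c + 1" and "hamming_dist u c \<le> k + 1"
  shows "\<exists>y. hamming_dist y c \<le> 1 \<and> hamming_dist u y = k"
proof -
  have le: "hamming_dist (vupd c i a) c \<le> 1" for i a
  proof -
    have "hamming_off i c c = 0"
      by (simp add: hamming_off_def)
    then show ?thesis
      by (simp add: hamming_dist_split[of _ _ i])
  qed
  consider "k = hamming_dist u c" | "k = hamming_dist u c + 1" | "k + 1 = hamming_dist u c"
    using assms by linarith
  then show ?thesis
  proof cases
    case 1
    then show ?thesis
      by (intro exI[of _ c]) simp
  next
    case 2
    then have "{i. u $ i \<noteq> c $ i} \<noteq> UNIV"
      using assms(1) by (auto simp: hamming_dist_def)
    then obtain i where i: "u $ i = c $ i"
      by auto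
    have "hamming_dist u (vupd c i (u $ i + 1)) = k"
      using 2 i by (simp add: hamming_dist_split[of u _ i])
    then show ?thesis
      using le by blast
  next
    case 3
    then have "u \<noteq> c"
      by auto
    then obtain i where i: "u $ i \<noteq> c $ i"
      by (auto simp: vec_eq_iff)
    have "hamming_dist u (vupd c i (u $ i)) = k"
      using 3 i by (simp add: hamming_dist_split[of u _ i])
    then show ?thesis
      using le by blast
  qed
qed

lemma graph_dist_folded:
  fixes u v :: "'f::{field,finite} ^ 'n::finite"
  assumes q: "CARD('f) = 2" and n: "even CARD('n)"
  shows "graph_dist (far_graph (CARD('n) - 1)) u v = enat (folded_dist CARD('n) (hamming_dist u v))"
proof (rule graph_dist_eq_potential)
  note le = hamming_dist_le_CARD[where 'a = 'f and 'n = 'n]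
  have "CARD('n) \<noteq> 1"
    using n by auto
  moreover have "0 < CARD('n)"
    by simp
  ultimately have d: "0 < CARD('n) - 1"
    by linarith
  \<comment> \<open>Being at distance at least \<open>n - 1\<close> means lying within 1 of the
    antipode, so neighbours have distances from \<open>u\<close> that add up to \<open>n\<close>
    within 1.\<close>
  have adj: "{x, y} \<in> edges (far_graph (CARD('n) - 1)) \<longleftrightarrow> hamming_dist x (antipode y) \<le> 1"
    for x y :: "'f ^ 'n"
    unfolding edges_far_graph[OF d] using hamming_dist_antipode[OF q, of x y] by linarith
  show "folded_dist CARD('n) (hamming_dist u x) = 0 \<longleftrightarrow> x = u" for x
    using folded_dist_eq_0_iff[OF n le] by auto
  show "folded_dist CARD('n) (hamming_dist u y) \<le> Suc (folded_dist CARD('n) (hamming_dist u x))"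
    if "{x, y} \<in> edges (far_graph (CARD('n) - 1))" for x y
  proof (rule folded_dist_lipschitz[OF n le])
    have xy: "hamming_dist x (antipode y) \<le> 1" "hamming_dist (antipode y) x \<le> 1"
      using that[unfolded adj] hamming_dist_commute[of x "antipode y"] by simp_all
    show "CARD('n) \<le> hamming_dist u x + hamming_dist u y + 1"
      using xy hamming_dist_antipode[OF q, of u y] hamming_dist_triangle[of u "antipode y" x] by linarith
    show "hamming_dist u x + hamming_dist u y \<le> CARD('n) + 1"
      using xy hamming_dist_antipode[OF q, of u y] hamming_dist_triangle[of u x "antipode y"] by linarith
  qed
  show "\<exists>y. {y, x} \<in> edges (far_graph (CARD('n) - 1)) \<and>
      Suc (folded_dist CARD('n) (hamming_dist u y)) = folded_dist CARD('n) (hamming_dist u x)"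
    if "folded_dist CARD('n) (hamming_dist u x) \<noteq> 0" for x
  proof -
    have "hamming_dist u x \<noteq> 0"
      using that folded_dist_eq_0_iff[OF n le] by metis
    then obtain w where w: "w \<le> CARD('n)" "CARD('n) \<le> hamming_dist u x + w + 1"
      "hamming_dist u x + w \<le> CARD('n) + 1"
      "Suc (folded_dist CARD('n) w) = folded_dist CARD('n) (hamming_dist u x)"
      using folded_dist_descent[OF n le] by metis
    \<comment> \<open>The antipode of \<open>x\<close> is at distance
      \<open>n - hamming_dist u x\<close> from \<open>u\<close>, so \<open>w\<close> is realised in
      the unit ball around it, that is, by a neighbour of \<open>x\<close>.\<close>
    have "w \<le> hamming_dist u (antipode x) + 1" "hamming_dist u (antipode x) \<le> w + 1"
      using w hamming_dist_antipode[OF q, of u x] by linarith+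
    from ex_hamming_step[OF w(1) this] show ?thesis
      using w(4) adj by metis
  qed
qed simp

text \<open>This linear map exchanges two of the \<open>n + 1\<close> generators: the all-ones vector, and the vector
  whose only zero is at \<open>k\<close>.\<close>

definition parity_map :: "'n::finite \<Rightarrow> 'f::comm_monoid_add ^ 'n \<Rightarrow> 'f ^ 'n" where
  "parity_map k x = vupd x k (\<Sum>i\<in>UNIV. x $ i)"

lemma parity_map_diff: "parity_map k (x - y) = parity_map k x - (parity_map k y :: 'f::field ^ 'n::finite)"
  by (simp add: parity_map_def vec_eq_iff sum_subtractf)

lemma hamming_dist_diff: "hamming_dist x y = hamming_dist (x - y) (0 :: 'f::field ^ 'n)"
  by (simp add: hamming_dist_def)

lemma sum_eq_0_iff_even:
  fixes x :: "'f::{field,finite} ^ 'n::finite"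
  assumes q: "CARD('f) = 2"
  shows "(\<Sum>i\<in>UNIV. x $ i) = 0 \<longleftrightarrow> even (hamming_dist x 0)"
proof -
  have "(\<Sum>i\<in>UNIV. x $ i) = (\<Sum>i\<in>UNIV. of_bool (x $ i \<noteq> 0))"
    using CARD_2_cases[OF q] by (intro sum.cong) (auto simp: of_bool_def)
  also have "\<dots> = of_nat (hamming_dist x 0)"
    by (simp add: hamming_dist_def)
  finally have sum: "(\<Sum>i\<in>UNIV. x $ i) = of_nat (hamming_dist x 0)" .
  have "(2 :: 'f) = 0"
    using CARD_2_add_self[OF q, of 1] by simp
  then have "of_nat m = (0 :: 'f) \<longleftrightarrow> even m" for m
    by (cases "even m") (auto elim!: evenE oddE)
  then show ?thesis
    by (simp add: sum)
qed

text \<open>Each application adds the sum \<open>r\<close> of the other entries to entry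
  \<open>k\<close>, and \<open>r + r = 0\<close>.\<close>

lemma parity_map_parity_map:
  fixes x :: "'f::{field,finite} ^ 'n::finite"
  assumes q: "CARD('f) = 2"
  shows "parity_map k (parity_map k x) = x"
proof -
  define r where "r = (\<Sum>i\<in>UNIV - {k}. x $ i)"
  have s: "(\<Sum>i\<in>UNIV. x $ i) = x $ k + r"
    by (simp add: r_def sum.remove)
  have "(\<Sum>i\<in>UNIV. parity_map k x $ i) = parity_map k x $ k + (\<Sum>i\<in>UNIV - {k}. parity_map k x $ i)"
    by (simp add: sum.remove)
  also have "(\<Sum>i\<in>UNIV - {k}. parity_map k x $ i) = r"
    unfolding r_def by (rule sum.cong) (auto simp: parity_map_def)
  also have "parity_map k x $ k + r = x $ k + (r + r)"
    by (simp add: parity_map_def s)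
  also have "\<dots> = x $ k"
    using CARD_2_add_self[OF q] by simp
  finally have "(\<Sum>i\<in>UNIV. parity_map k x $ i) = x $ k" .
  then show ?thesis
    unfolding parity_map_def[of k "parity_map k x"] by (simp add: parity_map_def vec_eq_iff)
qed

lemma hamming_dist_parity_map:
  fixes x :: "'f::{field,finite} ^ 'n::finite"
  assumes q: "CARD('f) = 2"
  shows "hamming_dist (parity_map k x) 0 = of_bool (odd (hamming_dist x 0)) + hamming_off k x 0"
  using sum_eq_0_iff_even[OF q, of x]
  by (simp add: parity_map_def hamming_dist_split[of "vupd x k _" 0 k])

text \<open>By linearity only weights matter. If weight at least \<open>d\<close> is not already
  reached off \<open>k\<close>, the weight is exactly \<open>d\<close>, which is odd since
  \<open>n\<close> is even, so the new entry at \<open>k\<close> is 1. The involution gives the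
  converse.\<close>

lemma automorphism_parity_map:
  fixes k :: "'n::finite"
  assumes q: "CARD('f::{field,finite}) = 2" and n: "even CARD('n)" and d: "d = CARD('n) - 1" "0 < d"
  shows "automorphism (far_graph d) (parity_map k :: 'f ^ 'n \<Rightarrow> 'f ^ 'n)"
proof (rule automorphism_far_graphI[OF d(2)])
  show "inj (parity_map k :: 'f ^ 'n \<Rightarrow> 'f ^ 'n)"
    by (metis parity_map_parity_map[OF q] injI)
  have far: "d \<le> hamming_dist (parity_map k z) 0" if "d \<le> hamming_dist z 0" for z :: "'f ^ 'n"
  proof (cases "d \<le> hamming_off k z 0")
    case True
    then show ?thesis
      by (simp add: hamming_dist_parity_map[OF q])
  next
    case False
    then have "hamming_dist z 0 = d" "hamming_off k z 0 = d - 1"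
      using that hamming_dist_split[of z 0 k] by (auto simp: of_bool_def split: if_splits)
    moreover have "odd d"
      using n d by simp
    ultimately show ?thesis
      by (simp add: hamming_dist_parity_map[OF q])
  qed
  show "d \<le> hamming_dist (parity_map k x) (parity_map k y) \<longleftrightarrow> d \<le> hamming_dist x y"
    for x y :: "'f ^ 'n"
  proof -
    have "hamming_dist (parity_map k x) (parity_map k y) = hamming_dist (parity_map k (x - y)) 0"
      by (subst hamming_dist_diff) (simp add: parity_map_diff)
    moreover have "hamming_dist x y = hamming_dist (x - y) 0"
      by (rule hamming_dist_diff)
    ultimately show ?thesis
      using far[of "x - y"] far[of "parity_map k (x - y)"] parity_map_parity_map[OF q, of k "x - y"]
      by auto
  qed
qed

text \<open>An odd distance is not \<open>n\<close>, so \<open>x\<close> and \<open>y\<close> agree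
  at some \<open>k\<close>; there \<open>parity_map k\<close> makes them differ, raising the
  distance to the next even number.\<close>

lemma same_orbit_even_weight:
  fixes x y :: "'f::{field,finite} ^ 'n::finite"
  assumes q: "CARD('f) = 2" and n: "even CARD('n)" and d: "d = CARD('n) - 1" "0 < d"
  shows "\<exists>x' y'. same_orbit d x y x' y' \<and> hamming_dist x' y' = 2 * ((hamming_dist x y + 1) div 2)"
proof (cases "even (hamming_dist x y)")
  case True
  then show ?thesis
    using same_orbit_hamming[OF d(2) refl, of x y] by (intro exI[of _ x] exI[of _ y]) auto
next
  case False
  then have odd: "odd (hamming_dist (x - y) 0)"
    using hamming_dist_diff[of x y] by simp
  then have "{i. (x - y) $ i \<noteq> 0 $ i} \<noteq> UNIV"
    using n by (metis hamming_dist_def)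
  then obtain k where k: "(x - y) $ k = 0 $ k"
    by blast
  have "hamming_dist (parity_map k x) (parity_map k y) = hamming_dist (parity_map k (x - y)) 0"
    by (subst hamming_dist_diff) (simp add: parity_map_diff)
  also have "\<dots> = Suc (hamming_dist (x - y) 0)"
    using odd k hamming_dist_split[of "x - y" 0 k] by (simp add: hamming_dist_parity_map[OF q])
  also have "\<dots> = 2 * ((hamming_dist x y + 1) div 2)"
    using False hamming_dist_diff[of x y] by simp
  finally have "hamming_dist (parity_map k x) (parity_map k y) = 2 * ((hamming_dist x y + 1) div 2)" .
  moreover have "same_orbit d x y (parity_map k x) (parity_map k y)"
    unfolding same_orbit_def using automorphism_parity_map[OF q n d, of k] by blast
  ultimately show ?thesis by blast
qed

text \<open>Equal graph distances give equal Hamming distances after rounding up to even numbers,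
  and each pair shares an orbit with one at the rounded distance.\<close>

lemma distance_transitive_folded:
  assumes q: "CARD('f) = 2" and n: "even CARD('n)" and d: "d = CARD('n) - 1" "0 < d"
  shows "distance_transitive (far_graph d :: ('f::{field,finite} ^ 'n::finite) ugraph)"
  unfolding distance_transitive_far_graph_iff
proof (intro allI impI)
  fix u1 u2 v1 v2 :: "'f ^ 'n"
  assume "graph_dist (far_graph d) v1 v2 = graph_dist (far_graph d) u1 u2"
  then have "folded_dist CARD('n) (hamming_dist v1 v2) = folded_dist CARD('n) (hamming_dist u1 u2)"
    using graph_dist_folded[OF q n] d(1) by simp
  then have eq: "(hamming_dist v1 v2 + 1) div 2 = (hamming_dist u1 u2 + 1) div 2"
    by (intro folded_dist_inj[OF n] hamming_dist_le_CARD)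
  obtain u1' u2' v1' v2' where
    u: "same_orbit d u1 u2 u1' u2'" "hamming_dist u1' u2' = 2 * ((hamming_dist u1 u2 + 1) div 2)" and
    v: "same_orbit d v1 v2 v1' v2'" "hamming_dist v1' v2' = 2 * ((hamming_dist v1 v2 + 1) div 2)"
    using same_orbit_even_weight[OF q n d] by metis
  have "same_orbit d v1' v2' u1' u2'"
    using d(2) u(2) v(2) eq by (intro same_orbit_hamming) simp_all
  then show "same_orbit d v1 v2 u1 u2"
    using d(2) u(1) v(1) same_orbit_trans same_orbit_sym by metis
qed

section \<open>Assembling the two characterisations\<close>

theorem theorem4p1p2:
  fixes q n d :: nat
    and G :: "('f::{field,finite} ^ 'n::finite) ugraph"
  assumes "primepow q" and "CARD('f) = q" and "CARD('n) = n"
    and "2 \<le> d" and "d \<le> n"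
    and "G = graph_complement (gen_hamming_graph d)"
  shows "(edge_transitive G \<longleftrightarrow> (q = 2 \<and> d = n - 1 \<and> even n) \<or> d = n) \<and>
         (distance_transitive G \<longleftrightarrow>
            (q = 2 \<and> d = n - 1 \<and> even n) \<or> (d = n \<and> (q = 2 \<or> n = 2)))"
proof -
  have d0: "0 < d"
    using assms(4) by simp
  have q: "q = 2 \<or> 3 \<le> q"
    using primepow_gt_Suc_0[OF assms(1)] by linarith
  have not_et: "(q = 2 \<and> d = n - 1 \<and> even n) \<or> d = n" if et: "edge_transitive G"
  proof (rule ccontr)
    assume neg: "\<not> ?thesis"
    then have "d < n"
      using assms(5) by simp
    with q consider "3 \<le> q" | "q = 2" "\<not> (d = n - 1 \<and> even n)"
      using neg by blast
    then show False
    proof cases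
      case 1
      then show False
        using not_edge_transitive_q_ge_3[where 'f = 'f and 'n = 'n and d = d] et \<open>d < n\<close> assms
        by simp
    next
      case 2
      \<comment> \<open>The least even number that is at least \<open>d\<close> can reach
        \<open>n\<close> only when \<open>d\<close> is odd and \<open>d + 1 = n\<close>, which is
        the excluded case.\<close>
      then have "2 * ((d + 1) div 2) < n"
        using \<open>d < n\<close> by presburger
      moreover have "d \<le> 2 * ((d + 1) div 2)"
        by simp
      ultimately show False
        using not_edge_transitive_parity[where 'f = 'f and 'n = 'n and d = d] et assms
        by blast
    qed
  qed
  have folded: "distance_transitive G" if "q = 2 \<and> d = n - 1 \<and> even n"
    using distance_transitive_folded[where 'f = 'f and 'n = 'n and d = d] that d0 assms by simp
  have et_n: "edge_transitive G" if "d = n"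
    using edge_transitive_d_eq_n[where 'f = 'f and 'n = 'n] that assms by simp
  have dt_n: "distance_transitive G \<longleftrightarrow> q = 2 \<or> n = 2" if "d = n"
  proof
    show "distance_transitive G" if "q = 2 \<or> n = 2"
      using distance_transitive_d_eq_n[where 'f = 'f and 'n = 'n] that \<open>d = n\<close> assms by simp
    show "q = 2 \<or> n = 2" if "distance_transitive G"
    proof (rule ccontr)
      assume "\<not> ?thesis"
      then have "3 \<le> q" "3 \<le> n"
        using q assms by linarith+
      then show False
        using not_distance_transitive_d_eq_n[where 'f = 'f and 'n = 'n] that \<open>d = n\<close> assms by simp
    qed
  qed
  have dt_et: "edge_transitive G" if "distance_transitive G"
    using distance_transitive_imp_edge_transitive[OF d0] that assms(6) by simp
  show ?thesis
    using not_et folded et_n dt_n dt_et by blast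
qed

end
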